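(* Let $(\alpha,\beta)\subseteq\mathbb{R}$ be a bounded interval and let $\rho_1,\rho_2:[\alpha,\beta]\to\mathbb{R}$ be positive $C^1$ functions. Let $0=\mu_0\le\mu_1\le\mu_2\le\dots$ be the eigenvalues (counted with multiplicity) of the Sturm–Liouville problem $$\begin{cases}-(\rho_1u')'=\mu\,\rho_2u&\text{on }(\alpha,\beta),\\ u'(\alpha)=u'(\beta)=0.\end{cases}$$ Then for every integer $k\ge0$, $$\mu_k\le\frac{\|\rho_1\|_\infty}{\|\rho_2\|_\infty}\cdot\frac{\pi^2k^2}{\left(\min\left\{\dfrac{\int_\alpha^\beta\rho_1\,dx}{\|\rho_1\|_\infty},\ \dfrac{\int_\alpha^\beta\rho_2\,dx}{\|\rho_2\|_\infty}\right\}\right)^2}.$$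
   Context: $\|\cdot\|_\infty$ denotes the sup norm on $[\alpha,\beta]$. *)

theory Defs
  imports "HOL-Analysis.Analysis" "HOL-Library.Function_Algebras"
begin

text \<open>Derivatives at the endpoints are one-sided (the library's \<open>C1_differentiable_on\<close>
  would ask for two-sided ones).\<close>

definition C1_on :: "real set \<Rightarrow> (real \<Rightarrow> real) \<Rightarrow> bool" where
  "C1_on S f \<longleftrightarrow>
     (\<exists>D. (\<forall>x\<in>S. (f has_real_derivative D x) (at x within S)) \<and> continuous_on S D)"

definition sup_norm :: "real set \<Rightarrow> (real \<Rightarrow> real) \<Rightarrow> real" where
  "sup_norm S f = (SUP x\<in>S. \<bar>f x\<bar>)"

definition fun_scale :: "real \<Rightarrow> (real \<Rightarrow> real) \<Rightarrow> real \<Rightarrow> real" where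
  "fun_scale c f = (\<lambda>x. c * f x)"

global_interpretation fun_space: vector_space fun_scale
  by unfold_locales (auto simp: fun_scale_def fun_eq_iff algebra_simps)

definition neumann_solution ::
  "real \<Rightarrow> real \<Rightarrow> (real \<Rightarrow> real) \<Rightarrow> (real \<Rightarrow> real) \<Rightarrow> real \<Rightarrow> (real \<Rightarrow> real) \<Rightarrow> bool" where
  "neumann_solution \<alpha> \<beta> \<rho>1 \<rho>2 \<nu> u \<longleftrightarrow>
     (\<exists>u'. (\<forall>x\<in>{\<alpha>..\<beta>}. (u has_real_derivative u' x) (at x within {\<alpha>..\<beta>})) \<and>
           continuous_on {\<alpha>..\<beta>} u' \<and>
           (\<forall>x\<in>{\<alpha><..<\<beta>}.
              ((\<lambda>t. \<rho>1 t * u' t) has_real_derivative - (\<nu> * \<rho>2 x * u x)) (at x)) \<and>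
           u' \<alpha> = 0 \<and> u' \<beta> = 0)"

text \<open>Functions on \<open>[\<alpha>, \<beta>]\<close> are represented by their extension by zero, so that the dimension
  of the eigenspace does not see values outside the interval.\<close>

definition eigenspace ::
  "real \<Rightarrow> real \<Rightarrow> (real \<Rightarrow> real) \<Rightarrow> (real \<Rightarrow> real) \<Rightarrow> real \<Rightarrow> (real \<Rightarrow> real) set" where
  "eigenspace \<alpha> \<beta> \<rho>1 \<rho>2 \<nu> =
     {u. neumann_solution \<alpha> \<beta> \<rho>1 \<rho>2 \<nu> u \<and> (\<forall>x. x \<notin> {\<alpha>..\<beta>} \<longrightarrow> u x = 0)}"

definition eigenvalue ::
  "real \<Rightarrow> real \<Rightarrow> (real \<Rightarrow> real) \<Rightarrow> (real \<Rightarrow> real) \<Rightarrow> real \<Rightarrow> bool" where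
  "eigenvalue \<alpha> \<beta> \<rho>1 \<rho>2 \<nu> \<longleftrightarrow> (\<exists>u\<in>eigenspace \<alpha> \<beta> \<rho>1 \<rho>2 \<nu>. \<exists>x. u x \<noteq> 0)"

definition eigen_multiplicity ::
  "real \<Rightarrow> real \<Rightarrow> (real \<Rightarrow> real) \<Rightarrow> (real \<Rightarrow> real) \<Rightarrow> real \<Rightarrow> nat" where
  "eigen_multiplicity \<alpha> \<beta> \<rho>1 \<rho>2 \<nu> = fun_space.dim (eigenspace \<alpha> \<beta> \<rho>1 \<rho>2 \<nu>)"

text \<open>\<open>\<mu>\<close> lists all eigenvalues in nondecreasing order, each as often as its multiplicity.
  Eigenspaces of a second-order equation are finite-dimensional, so for an eigenvalue both sides
  of the last equation are positive and neither \<open>card\<close> nor \<open>dim\<close> takes its default value.\<close>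

definition enumerates_eigenvalues ::
  "real \<Rightarrow> real \<Rightarrow> (real \<Rightarrow> real) \<Rightarrow> (real \<Rightarrow> real) \<Rightarrow> (nat \<Rightarrow> real) \<Rightarrow> bool" where
  "enumerates_eigenvalues \<alpha> \<beta> \<rho>1 \<rho>2 \<mu> \<longleftrightarrow>
     mono \<mu> \<and> range \<mu> = {\<nu>. eigenvalue \<alpha> \<beta> \<rho>1 \<rho>2 \<nu>} \<and>
     (\<forall>\<nu>. eigenvalue \<alpha> \<beta> \<rho>1 \<rho>2 \<nu> \<longrightarrow>
          card {k. \<mu> k = \<nu>} = eigen_multiplicity \<alpha> \<beta> \<rho>1 \<rho>2 \<nu>)"

end

theory Submission
  imports Defs
begin

text \<open>Only the term \<open>\<integral>\<rho>\<^sub>2 / \<parallel>\<rho>\<^sub>2\<parallel>\<^sub>\<infinity>\<close> of the minimum matters. Let \<open>m\<close> be this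
  term, \<open>P = \<parallel>\<rho>\<^sub>1\<parallel>\<^sub>\<infinity>\<close>, \<open>W = \<parallel>\<rho>\<^sub>2\<parallel>\<^sub>\<infinity>\<close>, \<open>c = P \<pi> k / m\<close>, and use
  Pruefer coordinates \<open>u = R cos \<theta>\<close>, \<open>\<rho>\<^sub>1 u' = - c R sin \<theta>\<close>. The equation becomes
  \<open>\<theta>' = (\<nu> \<rho>\<^sub>2 / c) cos\<^sup>2 \<theta> + (c / \<rho>\<^sub>1) sin\<^sup>2 \<theta>\<close>, and \<open>\<nu>\<close> is an eigenvalue if the solution
  with \<open>\<theta>(\<alpha>) = 0\<close> has \<open>\<theta>(\<beta>) \<in> \<pi>\<int>\<close>. At \<open>\<nu> = 0\<close> the angle vanishes identically; at
  \<open>\<nu> = (P / W) \<pi>\<^sup>2 k\<^sup>2 / m\<^sup>2\<close> both coefficients are at least \<open>(\<pi> k / m) \<rho>\<^sub>2 / W\<close>, so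
  \<open>\<theta>(\<beta>) \<ge> \<pi> k\<close>. By continuity in \<open>\<nu>\<close> the values \<open>0, \<pi>, \<dots>, \<pi> k\<close> are all attained in between,
  which gives \<open>k + 1\<close> distinct eigenvalues up to the bound.\<close>

section \<open>Initial value problems depending continuously on a parameter\<close>

text \<open>The substitution \<open>t = a + s * (x - a)\<close> moves the variable endpoint into the
  integrand. What remains is an integral over the fixed interval [0, 1], which depends continuously
  on its parameters.\<close>

lemma continuous_on_integral_param:
  fixes g :: "real \<Rightarrow> 'p::topological_space \<Rightarrow> real"
  assumes g: "continuous_on ({a..b} \<times> S) (\<lambda>(t, p). g t p)"
  shows "continuous_on ({a..b} \<times> S) (\<lambda>(x, p). integral {a..x} (\<lambda>t. g t p))"
proof -
  have cont: "continuous_on (({a..b} \<times> S) \<times> cbox 0 1) (\<lambda>(z, s). g (a + s * (fst z - a)) (snd z))"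
  proof -
    have "a + s * (x - a) \<in> {a..b}" if "x \<in> {a..b}" "s \<in> {0..1}" for x s
    proof -
      have "0 \<le> s * (x - a)" "s * (x - a) \<le> x - a"
        using that by (auto intro: mult_left_le_one_le)
      then show ?thesis using that by auto
    qed
    then show ?thesis
      using continuous_on_compose2[OF g, of "({a..b} \<times> S) \<times> cbox 0 1"
          "\<lambda>z. (a + snd z * (fst (fst z) - a), snd (fst z))"]
      by (force simp: split_beta intro!: continuous_intros)
  qed
  from integral_continuous_on_param[OF cont]
  have *: "continuous_on ({a..b} \<times> S)
      (\<lambda>z. (fst z - a) * integral (cbox 0 1) (\<lambda>s. g (a + s * (fst z - a)) (snd z)))"
    by (intro continuous_intros)
  have eq: "integral {a..x} (\<lambda>t. g t p)
     = (x - a) * integral (cbox 0 1) (\<lambda>s. g (a + s * (x - a)) p)" if "x \<in> {a..b}" "p \<in> S" for x p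
  proof (cases "x = a")
    \<comment> \<open>The affine substitution has scale \<open>x - a\<close>, which must be nonzero;
      at \<open>x = a\<close> both sides vanish.\<close>
    case False
    have "continuous_on {a..x} (\<lambda>t. g t p)"
      using that by (intro continuous_on_compose2[OF g, of _ "\<lambda>t. (t, p)", simplified])
        (auto intro!: continuous_intros)
    then have "((\<lambda>t. g t p) has_integral integral {a..x} (\<lambda>t. g t p)) (cbox a x)"
      by (auto intro: integrable_integral integrable_continuous_real)
    from has_integral_affinity'[OF this, of "x - a" a] False that
    show ?thesis by (auto simp: mult.commute add.commute field_simps dest!: integral_unique)
  qed simp
  show ?thesis
    by (rule continuous_on_eq[OF *]) (auto simp: eq)
qed

text \<open>Picard iteration for y' = f t p y, y(a) = 0, run on functions of \<open>(x, p)\<close>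
  jointly, so that the uniform limit is continuous in the parameter as well. The Lipschitz bound in
  y is global, so the solution exists on all of [a, b].\<close>

lemma picard_lindelof_param:
  fixes f :: "real \<Rightarrow> 'p::topological_space \<Rightarrow> real \<Rightarrow> real"
  assumes f: "continuous_on ({a..b} \<times> S \<times> UNIV) (\<lambda>(t, p, y). f t p y)"
    and S: "compact S" and L: "L > 0"
    and lip: "\<And>t p y z. t \<in> {a..b} \<Longrightarrow> p \<in> S \<Longrightarrow> \<bar>f t p y - f t p z\<bar> \<le> L * \<bar>y - z\<bar>"
  obtains h where "continuous_on ({a..b} \<times> S) h"
    "\<And>x p. x \<in> {a..b} \<Longrightarrow> p \<in> S \<Longrightarrow> h (x, p) = integral {a..x} (\<lambda>t. f t p (h (t, p)))"
proof -
  define D where "D = {a..b} \<times> S"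
  define T where "T h = (\<lambda>(x, p). integral {a..x} (\<lambda>t. f t p (h (t, p))))" for h
  \<comment> \<open>Weight of a Bielecki norm: the integral of \<open>L * E\<close> from a to x is
    at most \<open>E x / 2\<close>, so \<open>T\<close> contracts by 1/2 in the weighted sup norm,
    however long the interval is.\<close>
  define E where "E x = exp (2 * L * (x - a))" for x
  have fh: "continuous_on D (\<lambda>(t, p). f t p (h (t, p)))" if "continuous_on D h" for h
  proof -
    have "continuous_on D (\<lambda>z. (fst z, snd z, h z))"
      using that by (intro continuous_intros)
    from continuous_on_compose2[OF f this] show ?thesis
      by (force simp: D_def split_beta)
  qed
  have T_cont: "continuous_on D (T h)" if "continuous_on D h" for h
    using continuous_on_integral_param[OF fh[OF that, unfolded D_def]]
    unfolding T_def D_def .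
  have slice: "continuous_on {a..x} (\<lambda>t. f t p (h (t, p)))"
    if "continuous_on D h" "x \<in> {a..b}" "p \<in> S" for h x p
    using that by (intro continuous_on_compose2[OF fh[OF that(1)], of _ "\<lambda>t. (t, p)", simplified])
        (auto intro!: continuous_intros simp: D_def)
  have T_contr: "\<bar>T h (x, p) - T g (x, p)\<bar> \<le> C / 2 * E x"
    if h: "continuous_on D h" and g: "continuous_on D g" and C: "C \<ge> 0"
      and hg: "\<And>x p. x \<in> {a..b} \<Longrightarrow> p \<in> S \<Longrightarrow> \<bar>h (x, p) - g (x, p)\<bar> \<le> C * E x"
      and x: "x \<in> {a..b}" and p: "p \<in> S" for h g C x p
  proof -
    have "((\<lambda>t. L * (C * E t)) has_integral C / 2 * E x - C / 2 * E a) {a..x}"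
      using x L unfolding E_def
      by (intro fundamental_theorem_of_calculus)
        (auto intro!: derivative_eq_intros simp: has_real_derivative_iff_has_vector_derivative[symmetric])
    then have I: "(\<lambda>t. L * (C * E t)) integrable_on {a..x}"
      "integral {a..x} (\<lambda>t. L * (C * E t)) = C / 2 * E x - C / 2 * E a"
      by (auto simp: has_integral_iff)
    have i: "(\<lambda>t. f t p (h (t, p))) integrable_on {a..x}"
      "(\<lambda>t. f t p (g (t, p))) integrable_on {a..x}"
      using slice[OF h x p] slice[OF g x p] by (auto intro: integrable_continuous_real)
    have "\<bar>T h (x, p) - T g (x, p)\<bar>
        = norm (integral {a..x} (\<lambda>t. f t p (h (t, p)) - f t p (g (t, p))))"
      using i by (simp add: T_def integral_diff)
    also have "\<dots> \<le> integral {a..x} (\<lambda>t. L * (C * E t))"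
    proof (rule integral_norm_bound_integral)
      fix t assume t: "t \<in> {a..x}"
      then have "\<bar>f t p (h (t, p)) - f t p (g (t, p))\<bar> \<le> L * \<bar>h (t, p) - g (t, p)\<bar>"
        using x p by (intro lip) auto
      also have "\<dots> \<le> L * (C * E t)"
        using L t x p by (intro mult_left_mono hg) auto
      finally show "norm (f t p (h (t, p)) - f t p (g (t, p))) \<le> L * (C * E t)" by simp
    qed (use i I in \<open>auto intro: integrable_diff\<close>)
    also have "\<dots> \<le> C / 2 * E x" using C unfolding I by (simp add: E_def)
    finally show ?thesis .
  qed
  define \<phi> where "\<phi> n = (T ^^ n) (\<lambda>_. 0)" for n
  have \<phi>_Suc: "\<phi> (Suc n) = T (\<phi> n)" for n by (simp add: \<phi>_def)
  have \<phi>_cont: "continuous_on D (\<phi> n)" for n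
    by (induction n) (auto simp: \<phi>_Suc T_cont, simp add: \<phi>_def)
  have E_mono: "E x \<le> E b" if "x \<in> {a..b}" for x using that L by (simp add: E_def)
  have E_ge1: "E x \<ge> 1" if "x \<in> {a..b}" for x using that L by (simp add: E_def)
  have E_pos: "E x > 0" for x by (simp add: E_def)
  have "compact (\<phi> 1 ` D)"
    using S \<phi>_cont by (intro compact_continuous_image) (auto simp: D_def compact_Times)
  then obtain M0 where M0: "\<And>z. z \<in> D \<Longrightarrow> \<bar>\<phi> 1 z\<bar> \<le> M0"
    using compact_imp_bounded[of "\<phi> 1 ` D"] by (auto simp: bounded_iff)
  \<comment> \<open>If \<open>D\<close> is empty, \<open>M0\<close> may be negative, whereas
    \<open>T_contr\<close> asks for a nonnegative constant.\<close>
  define M where "M = max 0 M0"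
  have step: "\<bar>\<phi> (Suc n) (x, p) - \<phi> n (x, p)\<bar> \<le> M / 2 ^ n * E x"
    if "x \<in> {a..b}" "p \<in> S" for n x p
    using that
  proof (induction n arbitrary: x p)
    case 0
    have "\<bar>\<phi> 1 (x, p)\<bar> \<le> M * 1" using M0[of "(x, p)"] 0 by (auto simp: D_def M_def)
    also have "\<dots> \<le> M * E x" using E_ge1[OF 0(1)] by (intro mult_left_mono) (auto simp: M_def)
    finally show ?case by (simp add: \<phi>_def)
  next
    case (Suc n)
    then show ?case
      using T_contr[OF \<phi>_cont[of "Suc n"] \<phi>_cont[of n], of "M / 2 ^ n" x p]
      by (auto simp: \<phi>_Suc[symmetric] M_def)
  qed
  \<comment> \<open>The limit of the iterates as a telescoping series. By \<open>step\<close> it is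
    dominated by a geometric series, and its partial sums are the \<open>\<phi> n\<close> because
    \<open>\<phi> 0 = 0\<close>.\<close>
  define h where "h z = (\<Sum>n. \<phi> (Suc n) z - \<phi> n z)" for z
  have "uniform_limit D (\<lambda>n z. \<Sum>i<n. \<phi> (Suc i) z - \<phi> i z) h sequentially"
    unfolding h_def
  proof (rule Weierstrass_m_test)
    fix n z assume "z \<in> D"
    then obtain x p where z: "z = (x, p)" "x \<in> {a..b}" "p \<in> S" by (auto simp: D_def)
    have "M / 2 ^ n * E x \<le> M / 2 ^ n * E b"
      using E_mono[OF z(2)] by (intro mult_left_mono) (auto simp: M_def)
    then show "norm (\<phi> (Suc n) z - \<phi> n z) \<le> M * E b * (1 / 2) ^ n"
      using step[OF z(2,3), of n] z(1) by (simp add: power_one_over field_simps)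
  qed (intro summable_mult summable_geometric, simp)
  moreover have "(\<Sum>i<n. \<phi> (Suc i) z - \<phi> i z) = \<phi> n z" for n z
    using sum_lessThan_telescope[of "\<lambda>i. \<phi> i z" n] by (simp add: \<phi>_def)
  ultimately have lim: "uniform_limit D \<phi> h sequentially" by simp
  have h_cont: "continuous_on D h"
    using \<phi>_cont by (intro uniform_limit_theorem[OF _ lim]) auto
  have "h (x, p) = T h (x, p)" if x: "x \<in> {a..b}" and p: "p \<in> S" for x p
  proof (rule LIMSEQ_unique)
    have z: "(x, p) \<in> D" using x p by (simp add: D_def)
    show "(\<lambda>n. \<phi> (Suc n) (x, p)) \<longlonglongrightarrow> h (x, p)"
      using tendsto_uniform_limitI[OF lim z] by (rule LIMSEQ_Suc)
    show "(\<lambda>n. \<phi> (Suc n) (x, p)) \<longlonglongrightarrow> T h (x, p)"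
    proof (rule tendstoI)
      fix e :: real assume e: "e > 0"
      \<comment> \<open>Since \<open>E \<ge> 1\<close>, uniform closeness \<open>e / E x\<close> is
        also closeness in the weighted norm; \<open>T_contr\<close> at x then gives the distance e /
        2.\<close>
      have "\<forall>\<^sub>F n in sequentially. \<forall>z\<in>D. dist (\<phi> n z) (h z) < e / E x"
        using lim e E_pos by (intro uniform_limitD) auto
      then show "\<forall>\<^sub>F n in sequentially. dist (\<phi> (Suc n) (x, p)) (T h (x, p)) < e"
      proof eventually_elim
        case (elim n)
        have "\<bar>\<phi> n (s, q) - h (s, q)\<bar> \<le> e / E x * E s" if "s \<in> {a..b}" "q \<in> S" for s q
        proof -
          have "\<bar>\<phi> n (s, q) - h (s, q)\<bar> \<le> e / E x * 1"
            using elim that by (force simp: D_def dist_real_def)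
          also have "\<dots> \<le> e / E x * E s"
            using e E_pos[of x] E_ge1[OF that(1)] by (intro mult_left_mono) auto
          finally show ?thesis .
        qed
        then have "\<bar>T (\<phi> n) (x, p) - T h (x, p)\<bar> \<le> e / E x / 2 * E x"
          using e E_pos[of x] x p by (intro T_contr \<phi>_cont h_cont) auto
        then show ?case using e E_pos[of x] by (simp add: dist_real_def \<phi>_Suc)
      qed
    qed
  qed
  with h_cont show ?thesis by (intro that) (auto simp: D_def T_def)
qed

section \<open>From the Pruefer angle to an eigenfunction\<close>

text \<open>The amplitude R can be recovered from the angle by one integration. The derivative of
  \<open>R cos \<theta>\<close> is a multiple of \<open>sin \<theta>\<close>, so the Neumann
  conditions become \<open>bc\<close>, and \<open>sin (\<theta> \<alpha>) = 0\<close> forces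
  \<open>cos (\<theta> \<alpha>) = \<plusminus>1\<close>, so the function is not zero.\<close>

lemma eigenvalue_pruefer:
  assumes ab: "\<alpha> < \<beta>" and c: "c > 0"
    and cont: "continuous_on {\<alpha>..\<beta>} \<rho>1" "continuous_on {\<alpha>..\<beta>} \<rho>2"
    and pos: "\<And>x. x \<in> {\<alpha>..\<beta>} \<Longrightarrow> \<rho>1 x > 0"
    and \<theta>: "\<And>x. x \<in> {\<alpha>..\<beta>} \<Longrightarrow> (\<theta> has_real_derivative
          \<nu> * \<rho>2 x / c * (cos (\<theta> x))\<^sup>2 + c / \<rho>1 x * (sin (\<theta> x))\<^sup>2) (at x within {\<alpha>..\<beta>})"
    and bc: "sin (\<theta> \<alpha>) = 0" "sin (\<theta> \<beta>) = 0"
  shows "eigenvalue \<alpha> \<beta> \<rho>1 \<rho>2 \<nu>"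
proof -
  \<comment> \<open>The logarithmic derivative R'/R, determined by the requirement that
    \<open>R cos \<theta>\<close> have derivative
    \<open>- (c / \<rho>1) R sin \<theta>\<close>.\<close>
  define q where "q x = (\<nu> * \<rho>2 x / c - c / \<rho>1 x) * sin (\<theta> x) * cos (\<theta> x)" for x
  define R where "R x = exp (integral {\<alpha>..x} q)" for x
  define u where "u x = (if x \<in> {\<alpha>..\<beta>} then R x * cos (\<theta> x) else 0)" for x
  define u' where "u' x = - (c / \<rho>1 x) * (R x * sin (\<theta> x))" for x
  have \<theta>_cont: "continuous_on {\<alpha>..\<beta>} \<theta>"
    by (rule DERIV_continuous_on[OF \<theta>])
  have nz: "\<rho>1 x \<noteq> 0" if "x \<in> {\<alpha>..\<beta>}" for x using pos[OF that] by simp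
  have q_cont: "continuous_on {\<alpha>..\<beta>} q"
    unfolding q_def using nz c by (intro continuous_intros cont \<theta>_cont) auto
  have R': "(R has_real_derivative R x * q x) (at x within {\<alpha>..\<beta>})" if "x \<in> {\<alpha>..\<beta>}" for x
    unfolding R_def
    by (rule derivative_eq_intros integral_has_real_derivative[OF q_cont that])+ simp
  have R_cont: "continuous_on {\<alpha>..\<beta>} R"
    by (rule DERIV_continuous_on[OF R'])
  have s: "(sin y)\<^sup>2 = 1 - (cos y)\<^sup>2" for y :: real by (simp add: sin_squared_eq)
  have du: "(u has_real_derivative u' x) (at x within {\<alpha>..\<beta>})" if x: "x \<in> {\<alpha>..\<beta>}" for x
  proof (rule has_field_derivative_transform_within[of _ _ _ _ 1])
    have "R x * q x * cos (\<theta> x) - R x * (sin (\<theta> x) *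
        (\<nu> * \<rho>2 x / c * (cos (\<theta> x))\<^sup>2 + c / \<rho>1 x * (sin (\<theta> x))\<^sup>2)) = u' x"
      unfolding q_def u'_def s by (simp add: algebra_simps power2_eq_square)
    then show "((\<lambda>x. R x * cos (\<theta> x)) has_real_derivative u' x) (at x within {\<alpha>..\<beta>})"
      by (auto intro!: derivative_eq_intros R' \<theta> x simp: mult.commute mult.left_commute)
  qed (use x in \<open>auto simp: u_def\<close>)
  have dv: "((\<lambda>t. \<rho>1 t * u' t) has_real_derivative - (\<nu> * \<rho>2 x * u x)) (at x)"
    if x: "x \<in> {\<alpha><..<\<beta>}" for x
  proof -
    have x': "x \<in> {\<alpha>..\<beta>}" using x by auto
    \<comment> \<open>The terms with \<open>c / \<rho>1 x\<close> cancel. The factor sin^2 + cos^2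
      is kept unsimplified, so that expanding both sides gives the same polynomial in sine and
      cosine.\<close>
    have "- c * (R x * q x * sin (\<theta> x) + R x * (cos (\<theta> x) *
        (\<nu> * \<rho>2 x / c * (cos (\<theta> x))\<^sup>2 + c / \<rho>1 x * (sin (\<theta> x))\<^sup>2)))
       = - (c * (\<nu> * \<rho>2 x / c)) * R x * cos (\<theta> x) * ((sin (\<theta> x))\<^sup>2 + (cos (\<theta> x))\<^sup>2)"
      (is "?lhs = _")
      unfolding q_def by (simp add: algebra_simps power2_eq_square
          del: sin_cos_squared_add sin_cos_squared_add3)
    also have "\<dots> = - (\<nu> * \<rho>2 x * u x)" using c x' by (simp add: u_def)
    finally have eq: "?lhs = - (\<nu> * \<rho>2 x * u x)" .
    have "((\<lambda>x. - c * (R x * sin (\<theta> x))) has_real_derivative - (\<nu> * \<rho>2 x * u x))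
        (at x within {\<alpha>..\<beta>})"
      unfolding eq[symmetric]
      by (auto intro!: derivative_eq_intros R' \<theta> x' simp: mult.commute mult.left_commute)
    then have "((\<lambda>t. \<rho>1 t * u' t) has_real_derivative - (\<nu> * \<rho>2 x * u x)) (at x within {\<alpha>..\<beta>})"
      by (rule has_field_derivative_transform_within[of _ _ _ _ 1])
        (use x' nz in \<open>auto simp: u'_def\<close>)
    then show ?thesis using x by (simp add: at_within_Icc_at)
  qed
  have u'_cont: "continuous_on {\<alpha>..\<beta>} u'"
    unfolding u'_def using nz by (intro continuous_intros cont \<theta>_cont R_cont) auto
  have "u \<in> eigenspace \<alpha> \<beta> \<rho>1 \<rho>2 \<nu>"
    unfolding eigenspace_def neumann_solution_def using du dv u'_cont bc
    by (auto simp: u_def u'_def intro!: exI[of _ u'])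
  moreover have "u \<alpha> \<noteq> 0"
    using ab bc(1) sin_zero_abs_cos_one[of "\<theta> \<alpha>"] by (auto simp: u_def R_def)
  ultimately show ?thesis unfolding eigenvalue_def by blast
qed

section \<open>Counting values, and a Lipschitz bound for the angle equation\<close>

text \<open>Pigeonhole: if \<open>\<mu> k\<close> exceeded B, then by monotonicity every value up to
  B would have an index below k. That leaves room for at most k values, but \<open>g\<close>
  supplies k + 1.\<close>

lemma mono_le_if_many_values:
  fixes \<mu> :: "nat \<Rightarrow> 'a::linorder"
  assumes "mono \<mu>" "inj_on g {..k}" "\<And>j. j \<le> k \<Longrightarrow> g j \<in> range \<mu>" "\<And>j. j \<le> k \<Longrightarrow> g j \<le> (B::'a)"
  shows "\<mu> k \<le> B"
proof (rule ccontr)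
  assume B: "\<not> \<mu> k \<le> B"
  have "g ` {..k::nat} \<subseteq> \<mu> ` {..<k}"
  proof (clarify)
    fix j assume "j \<le> k"
    then obtain i where i: "g j = \<mu> i" "\<mu> i \<le> B" using assms(3,4)[of j] by auto
    with B assms(1) have "i < k" by (metis monoD not_less order_trans)
    with i show "g j \<in> \<mu> ` {..<k}" by auto
  qed
  then have "card (g ` {..k}) \<le> card (\<mu> ` {..<k})" by (intro card_mono) auto
  also have "\<dots> \<le> k" using card_image_le[of "{..<k}" \<mu>] by simp
  finally show False using assms(2) by (simp add: card_image)
qed

text \<open>Mean value inequality: the derivative is \<open>2 * (B - A) * (sin y * cos y)\<close>,
  and \<open>\<bar>B - A\<bar> \<le> A + B\<close> for nonnegative A and B.\<close>

lemma lipschitz_pruefer: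
  fixes A B y z :: real
  assumes "0 \<le> A" "0 \<le> B"
  shows "\<bar>(A * (cos y)\<^sup>2 + B * (sin y)\<^sup>2) - (A * (cos z)\<^sup>2 + B * (sin z)\<^sup>2)\<bar> \<le> 2 * (A + B) * \<bar>y - z\<bar>"
proof -
  have "norm ((A * (cos y)\<^sup>2 + B * (sin y)\<^sup>2) - (A * (cos z)\<^sup>2 + B * (sin z)\<^sup>2))
      \<le> 2 * (A + B) * norm (y - z)"
  proof (rule field_differentiable_bound[of UNIV _ "\<lambda>y. 2 * (B - A) * (sin y * cos y)"])
    fix y
    show "((\<lambda>y. A * (cos y)\<^sup>2 + B * (sin y)\<^sup>2) has_field_derivative 2 * (B - A) * (sin y * cos y))
        (at y within UNIV)"
      by (auto intro!: derivative_eq_intros simp: algebra_simps)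
    have "\<bar>sin y\<bar> * \<bar>cos y\<bar> \<le> 1 * 1" by (intro mult_mono) auto
    then have "\<bar>2 * (B - A)\<bar> * (\<bar>sin y\<bar> * \<bar>cos y\<bar>) \<le> 2 * (A + B) * (1 * 1)"
      using assms by (intro mult_mono) auto
    then show "norm (2 * (B - A) * (sin y * cos y)) \<le> 2 * (A + B)" by (simp add: abs_mult)
  qed auto
  then show ?thesis by simp
qed

section \<open>Shooting in the spectral parameter\<close>

text \<open>With \<nu> in the compact interval [0, \<Lambda>] as the parameter of the initial value
  problem, the angle at \<beta> is continuous in \<nu>, and the intermediate value theorem applies.
  The eigenvalues found are distinct because their end angles \<open>pi * j\<close> are.\<close>

lemma eigenvalues_up_to_bound:
  assumes ab: "\<alpha> < \<beta>" and k: "k > 0"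
    and cont: "continuous_on {\<alpha>..\<beta>} \<rho>1" "continuous_on {\<alpha>..\<beta>} \<rho>2"
    and pos: "\<And>x. x \<in> {\<alpha>..\<beta>} \<Longrightarrow> \<rho>1 x > 0" "\<And>x. x \<in> {\<alpha>..\<beta>} \<Longrightarrow> \<rho>2 x > 0"
    and P: "\<And>x. x \<in> {\<alpha>..\<beta>} \<Longrightarrow> \<rho>1 x \<le> P" and W: "\<And>x. x \<in> {\<alpha>..\<beta>} \<Longrightarrow> \<rho>2 x \<le> W"
    and m: "m = integral {\<alpha>..\<beta>} \<rho>2 / W" "m > 0"
    and \<Lambda>: "\<Lambda> = P / W * (pi\<^sup>2 * (real k)\<^sup>2 / m\<^sup>2)"
  obtains g where "inj_on g {..k}" "\<And>j. j \<le> k \<Longrightarrow> eigenvalue \<alpha> \<beta> \<rho>1 \<rho>2 (g j)"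
    "\<And>j. j \<le> k \<Longrightarrow> g j \<le> \<Lambda>"
proof -
  have \<alpha>: "\<alpha> \<in> {\<alpha>..\<beta>}" and \<beta>: "\<beta> \<in> {\<alpha>..\<beta>}" using ab by auto
  have P0: "P > 0" and W0: "W > 0" using pos[OF \<alpha>] P[OF \<alpha>] W[OF \<alpha>] by auto
  \<comment> \<open>This scale balances the two coefficients at \<nu> = \<Lambda>: both
    \<open>\<Lambda> * W / c\<close> and \<open>c / P\<close> equal
    \<open>pi * k / m\<close>.\<close>
  define c where "c = P * pi * k / m"
  have c: "c > 0" using P0 k m(2) by (simp add: c_def)
  have \<Lambda>0: "\<Lambda> > 0" using P0 W0 k m(2) by (simp add: \<Lambda>)
  define f where "f t \<nu> y = \<nu> * \<rho>2 t / c * (cos y)\<^sup>2 + c / \<rho>1 t * (sin y)\<^sup>2" for t \<nu> y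
  have nz: "\<rho>1 x \<noteq> 0" if "x \<in> {\<alpha>..\<beta>}" for x using pos(1)[OF that] by simp
  have c1: "continuous_on ({\<alpha>..\<beta>} \<times> {0..\<Lambda>} \<times> UNIV) (\<lambda>z. \<rho>1 (fst z))"
    and c2: "continuous_on ({\<alpha>..\<beta>} \<times> {0..\<Lambda>} \<times> UNIV) (\<lambda>z. \<rho>2 (fst z))"
    by (rule continuous_on_compose2[OF cont(1)] continuous_on_compose2[OF cont(2)],
        auto intro!: continuous_intros)+
  have f_cont: "continuous_on ({\<alpha>..\<beta>} \<times> {0..\<Lambda>} \<times> UNIV) (\<lambda>(t, \<nu>, y). f t \<nu> y)"
    unfolding f_def split_beta using nz c by (intro continuous_intros c1 c2) auto
  have "compact ((\<lambda>t. c / \<rho>1 t) ` {\<alpha>..\<beta>})"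
    using nz by (intro compact_continuous_image continuous_intros cont) auto
  then obtain B0 where "\<forall>t\<in>{\<alpha>..\<beta>}. \<bar>c / \<rho>1 t\<bar> \<le> B0"
    using compact_imp_bounded[of "(\<lambda>t. c / \<rho>1 t) ` {\<alpha>..\<beta>}"] by (auto simp: bounded_iff)
  then have B0: "\<And>t. t \<in> {\<alpha>..\<beta>} \<Longrightarrow> c / \<rho>1 t \<le> B0" by (meson abs_le_D1)
  \<comment> \<open>The constant of \<open>lipschitz_pruefer\<close>, with the two coefficients
    replaced by upper bounds uniform in t and \<nu>.\<close>
  define L where "L = 2 * (\<Lambda> * W / c + B0)"
  have "c / \<rho>1 \<alpha> > 0" using c pos(1)[OF \<alpha>] by simp
  then have "B0 > 0" using B0[OF \<alpha>] by linarith
  then have L: "L > 0" using \<Lambda>0 W0 c by (simp add: L_def add_pos_pos)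
  have lip: "\<bar>f t \<nu> y - f t \<nu> z\<bar> \<le> L * \<bar>y - z\<bar>" if t: "t \<in> {\<alpha>..\<beta>}" and \<nu>: "\<nu> \<in> {0..\<Lambda>}" for t \<nu> y z
  proof -
    have "\<bar>f t \<nu> y - f t \<nu> z\<bar> \<le> 2 * (\<nu> * \<rho>2 t / c + c / \<rho>1 t) * \<bar>y - z\<bar>"
      unfolding f_def using t \<nu> c less_imp_le[OF pos(1)[OF t]] less_imp_le[OF pos(2)[OF t]]
      by (intro lipschitz_pruefer) auto
    also have "\<dots> \<le> L * \<bar>y - z\<bar>"
    proof -
      have "\<nu> * \<rho>2 t / c \<le> \<Lambda> * W / c"
        using t \<nu> c W[OF t] less_imp_le[OF pos(2)[OF t]]
        by (intro divide_right_mono mult_mono) auto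
      then show ?thesis unfolding L_def
        by (intro mult_right_mono mult_left_mono add_mono B0 t) auto
    qed
    finally show ?thesis .
  qed
  obtain h where h: "continuous_on ({\<alpha>..\<beta>} \<times> {0..\<Lambda>}) h"
    and h_eq: "\<And>x \<nu>. x \<in> {\<alpha>..\<beta>} \<Longrightarrow> \<nu> \<in> {0..\<Lambda>} \<Longrightarrow>
        h (x, \<nu>) = integral {\<alpha>..x} (\<lambda>t. f t \<nu> (h (t, \<nu>)))"
    using picard_lindelof_param[OF f_cont compact_Icc L lip] by blast
  have fh: "continuous_on {\<alpha>..\<beta>} (\<lambda>t. f t \<nu> (h (t, \<nu>)))" if \<nu>: "\<nu> \<in> {0..\<Lambda>}" for \<nu>
  proof -
    have "continuous_on {\<alpha>..\<beta>} (\<lambda>t. h (t, \<nu>))"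
      by (rule continuous_on_compose2[OF h]) (use \<nu> in \<open>auto intro!: continuous_intros\<close>)
    then have "continuous_on {\<alpha>..\<beta>} (\<lambda>t. (t, \<nu>, h (t, \<nu>)))" by (intro continuous_intros)
    from continuous_on_compose2[OF f_cont this] \<nu> show ?thesis by force
  qed
  have h': "((\<lambda>x. h (x, \<nu>)) has_real_derivative f x \<nu> (h (x, \<nu>))) (at x within {\<alpha>..\<beta>})"
    if "\<nu> \<in> {0..\<Lambda>}" "x \<in> {\<alpha>..\<beta>}" for \<nu> x
    using integral_has_real_derivative[OF fh[OF that(1)] that(2)]
    by (rule has_field_derivative_transform_within[of _ _ _ _ 1]) (use that in \<open>auto simp: h_eq\<close>)
  have h0: "h (\<alpha>, \<nu>) = 0" if "\<nu> \<in> {0..\<Lambda>}" for \<nu> using h_eq[OF \<alpha> that] by simp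
  have low: "h (\<beta>, 0) = 0"
  proof -
    txt \<open>Gronwall: \<open>\<bar>\<theta>'\<bar> \<le> L \<bar>\<theta>\<bar>\<close>, so \<open>\<theta>\<^sup>2 exp (-2 L x)\<close> is nonincreasing.\<close>
    have 0: "0 \<in> {0..\<Lambda>}" using \<Lambda>0 by auto
    let ?G = "\<lambda>x. (h (x, 0))\<^sup>2 * exp (- (2 * L * x))"
    have dG: "(?G has_real_derivative
        2 * (h (x, 0) * f x 0 (h (x, 0)) - L * (h (x, 0))\<^sup>2) * exp (- (2 * L * x)))
        (at x within {\<alpha>..\<beta>})" if "x \<in> {\<alpha>..\<beta>}" for x
      by (auto intro!: derivative_eq_intros h' 0 that simp: algebra_simps power2_eq_square)
    have "?G \<beta> \<le> ?G \<alpha>"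
    proof (rule DERIV_nonpos_imp_decreasing_open[where f = ?G])
      fix x assume "\<alpha> < x" "x < \<beta>"
      then have x: "x \<in> {\<alpha>..\<beta>}" "at x within {\<alpha>..\<beta>} = at x" by (auto simp: at_within_Icc_at)
      \<comment> \<open>Here \<open>f x 0 0 = 0\<close>, so the Lipschitz bound is used against the
        zero solution.\<close>
      have "\<bar>f x 0 (h (x, 0))\<bar> \<le> L * \<bar>h (x, 0)\<bar>"
        using lip[OF x(1) 0, of "h (x, 0)" 0] by (simp add: f_def)
      then have "\<bar>h (x, 0)\<bar> * \<bar>f x 0 (h (x, 0))\<bar> \<le> \<bar>h (x, 0)\<bar> * (L * \<bar>h (x, 0)\<bar>)"
        by (intro mult_left_mono) auto
      then have "h (x, 0) * f x 0 (h (x, 0)) \<le> L * (h (x, 0))\<^sup>2"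
        using abs_ge_self[of "h (x, 0) * f x 0 (h (x, 0))"]
        by (simp add: abs_mult power2_eq_square mult.left_commute flip: abs_mult)
      then have "2 * (h (x, 0) * f x 0 (h (x, 0)) - L * (h (x, 0))\<^sup>2) * exp (- (2 * L * x)) \<le> 0"
        by (simp add: mult_le_0_iff)
      with dG[OF x(1), unfolded x(2)]
      show "\<exists>y. (?G has_real_derivative y) (at x) \<and> y \<le> 0" by blast
    qed (use ab DERIV_continuous_on[OF dG] in auto)
    then show ?thesis using h0[OF 0] by (simp add: mult_le_0_iff)
  qed
  have high: "h (\<beta>, \<Lambda>) \<ge> pi * k"
  proof -
    have \<Lambda>I: "\<Lambda> \<in> {0..\<Lambda>}" using \<Lambda>0 by auto
    \<comment> \<open>At \<nu> = \<Lambda> the cosine coefficient equals A and the sine coefficient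
      is at least A, so cos^2 + sin^2 = 1 removes the unknown angle from the lower bound. By the
      choice of m the integral of this bound is exactly \<open>pi * k\<close>.\<close>
    have bound: "pi * k / (m * W) * \<rho>2 t \<le> f t \<Lambda> y" if t: "t \<in> {\<alpha>..\<beta>}" for t y
    proof -
      define A where "A = pi * k / (m * W) * \<rho>2 t"
      have 1: "\<Lambda> * \<rho>2 t / c = A"
        using P0 W0 m(2) k by (simp add: A_def \<Lambda> c_def power2_eq_square field_simps)
      have "A \<le> pi * k / (m * W) * W"
        unfolding A_def using W[OF t] W0 m(2) by (intro mult_left_mono) auto
      also have "\<dots> = c / P" using P0 W0 by (simp add: c_def)
      also have "\<dots> \<le> c / \<rho>1 t"
        using P[OF t] pos(1)[OF t] c by (intro divide_left_mono) auto
      finally have 2: "A \<le> c / \<rho>1 t" .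
      have "A = A * (cos y)\<^sup>2 + A * (sin y)\<^sup>2" by (simp flip: distrib_left)
      also have "\<dots> \<le> f t \<Lambda> y" unfolding f_def 1 using 2 by (intro add_mono mult_right_mono) auto
      finally show ?thesis by (simp add: A_def)
    qed
    have "pi * k = integral {\<alpha>..\<beta>} (\<lambda>t. pi * k / (m * W) * \<rho>2 t)"
    proof -
      have "integral {\<alpha>..\<beta>} \<rho>2 = m * W" using m(1) W0 by simp
      then show ?thesis using m(2) W0 by simp
    qed
    also have "\<dots> \<le> integral {\<alpha>..\<beta>} (\<lambda>t. f t \<Lambda> (h (t, \<Lambda>)))"
      using bound fh[OF \<Lambda>I] cont
      by (intro integral_le integrable_continuous_real continuous_intros) auto
    finally show ?thesis using h_eq[OF \<beta> \<Lambda>I] by simp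
  qed
  have end_cont: "continuous_on {0..\<Lambda>} (\<lambda>\<nu>. h (\<beta>, \<nu>))"
    by (rule continuous_on_compose2[OF h]) (use ab in \<open>auto intro!: continuous_intros\<close>)
  have "\<exists>\<nu>\<ge>0. \<nu> \<le> \<Lambda> \<and> h (\<beta>, \<nu>) = pi * j" if j: "j \<le> k" for j
  proof (rule IVT'[OF _ _ _ end_cont])
    have "pi * j \<le> pi * k" using j by simp
    then show "pi * j \<le> h (\<beta>, \<Lambda>)" using high by linarith
  qed (use low \<Lambda>0 in auto)
  \<comment> \<open>Moving \<open>j \<le> k\<close> under the existential makes the statement total
    in j, as the axiom of choice requires.\<close>
  then have "\<forall>j. \<exists>\<nu>. j \<le> k \<longrightarrow> \<nu> \<in> {0..\<Lambda>} \<and> h (\<beta>, \<nu>) = pi * j"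
    by (simp only: atLeastAtMost_iff) blast
  from choice[OF this] obtain g
    where g: "\<And>j. j \<le> k \<Longrightarrow> g j \<in> {0..\<Lambda>} \<and> h (\<beta>, g j) = pi * j" by blast
  show ?thesis
  proof (rule that[of g])
    show "inj_on g {..k}"
    proof (rule inj_onI)
      fix i j assume ij: "i \<in> {..k}" "j \<in> {..k}" "g i = g j"
      then have "h (\<beta>, g i) = pi * real i" "h (\<beta>, g j) = pi * real j"
        using g by blast+
      with ij(3) have "pi * real i = pi * real j" by metis
      then show "i = j" by simp
    qed
    fix j assume j: "j \<le> k"
    have gj: "g j \<in> {0..\<Lambda>}" "h (\<beta>, g j) = pi * j" using g[OF j] by blast+
    show "g j \<le> \<Lambda>" using gj(1) by simp
    have "sin (h (\<beta>, g j)) = 0" unfolding gj(2) by (simp add: mult.commute)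
    then show "eigenvalue \<alpha> \<beta> \<rho>1 \<rho>2 (g j)"
      using h'[OF gj(1)] h0[OF gj(1)]
      by (intro eigenvalue_pruefer[OF ab c cont pos(1), of "\<lambda>x. h (x, g j)"]) (simp_all add: f_def)
  qed
qed

section \<open>The eigenvalue bound\<close>

theorem corollary16:
  fixes \<alpha> \<beta> :: real and \<rho>1 \<rho>2 :: "real \<Rightarrow> real" and \<mu> :: "nat \<Rightarrow> real" and k :: nat
  assumes "\<alpha> < \<beta>"
    and "C1_on {\<alpha>..\<beta>} \<rho>1" and "C1_on {\<alpha>..\<beta>} \<rho>2"
    and "\<And>x. x \<in> {\<alpha>..\<beta>} \<Longrightarrow> \<rho>1 x > 0" and "\<And>x. x \<in> {\<alpha>..\<beta>} \<Longrightarrow> \<rho>2 x > 0"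
    and "enumerates_eigenvalues \<alpha> \<beta> \<rho>1 \<rho>2 \<mu>"
    and "\<mu> 0 = 0"
  shows "\<mu> k \<le> sup_norm {\<alpha>..\<beta>} \<rho>1 / sup_norm {\<alpha>..\<beta>} \<rho>2 *
    (pi\<^sup>2 * (real k)\<^sup>2 /
     (min (integral {\<alpha>..\<beta>} \<rho>1 / sup_norm {\<alpha>..\<beta>} \<rho>1)
          (integral {\<alpha>..\<beta>} \<rho>2 / sup_norm {\<alpha>..\<beta>} \<rho>2))\<^sup>2)"
proof (cases "k = 0")
  \<comment> \<open>The scale \<open>c\<close> of the Pruefer angle would be 0 here. The bound
    itself is 0, and so is \<open>\<mu> 0\<close>.\<close>
  case True
  then show ?thesis using assms(7) by simp
next
  case False
  note pos = assms(4,5)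
  have cont: "continuous_on {\<alpha>..\<beta>} \<rho>1" "continuous_on {\<alpha>..\<beta>} \<rho>2"
    using assms(2,3) by (auto simp: C1_on_def intro: DERIV_continuous_on)
  \<comment> \<open>A real supremum bounds its set only if the set is bounded above; compactness of
    the interval ensures this.\<close>
  have le_sup: "\<rho> x \<le> sup_norm {\<alpha>..\<beta>} \<rho>"
    if "continuous_on {\<alpha>..\<beta>} \<rho>" "x \<in> {\<alpha>..\<beta>}" for \<rho> x
  proof -
    have "compact ((\<lambda>x. \<bar>\<rho> x\<bar>) ` {\<alpha>..\<beta>})"
      using that by (intro compact_continuous_image continuous_intros) auto
    then have "\<bar>\<rho> x\<bar> \<le> sup_norm {\<alpha>..\<beta>} \<rho>"
      unfolding sup_norm_def using that(2)
      by (intro cSUP_upper bounded_imp_bdd_above compact_imp_bounded)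
    then show ?thesis by linarith
  qed
  have int_pos: "integral {\<alpha>..\<beta>} \<rho> > 0"
    if "continuous_on {\<alpha>..\<beta>} \<rho>" "\<And>x. x \<in> {\<alpha>..\<beta>} \<Longrightarrow> \<rho> x > 0" for \<rho> :: "real \<Rightarrow> real"
    using integral_less_real[OF continuous_on_const that(1), of 0] that(2) assms(1) by simp
  define P where "P = sup_norm {\<alpha>..\<beta>} \<rho>1"
  define W where "W = sup_norm {\<alpha>..\<beta>} \<rho>2"
  have PW: "P > 0" "W > 0"
    using le_sup[OF cont(1), of \<alpha>] le_sup[OF cont(2), of \<alpha>] pos[of \<alpha>] assms(1)
    by (auto simp: P_def W_def)
  define m1 where "m1 = integral {\<alpha>..\<beta>} \<rho>1 / P"
  define m2 where "m2 = integral {\<alpha>..\<beta>} \<rho>2 / W"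
  have m: "m1 > 0" "m2 > 0"
    using int_pos cont pos PW by (auto simp: m1_def m2_def)
  obtain g where g: "inj_on g {..k}" "\<And>j. j \<le> k \<Longrightarrow> eigenvalue \<alpha> \<beta> \<rho>1 \<rho>2 (g j)"
    "\<And>j. j \<le> k \<Longrightarrow> g j \<le> P / W * (pi\<^sup>2 * (real k)\<^sup>2 / m2\<^sup>2)"
  proof (rule eigenvalues_up_to_bound[OF assms(1) _ cont pos _ _ m2_def m(2) refl])
    show "\<rho>1 x \<le> P" "\<rho>2 x \<le> W" if "x \<in> {\<alpha>..\<beta>}" for x
      using le_sup cont that by (auto simp: P_def W_def)
  qed (use False in auto)
  have "mono \<mu>" "range \<mu> = {\<nu>. eigenvalue \<alpha> \<beta> \<rho>1 \<rho>2 \<nu>}"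
    using assms(6) by (auto simp: enumerates_eigenvalues_def)
  with g have "\<mu> k \<le> P / W * (pi\<^sup>2 * (real k)\<^sup>2 / m2\<^sup>2)"
    by (intro mono_le_if_many_values[of \<mu> g]) auto
  \<comment> \<open>Passing to the minimum can only shrink the positive denominator, which weakens
    the bound.\<close>
  also have "\<dots> \<le> P / W * (pi\<^sup>2 * (real k)\<^sup>2 / (min m1 m2)\<^sup>2)"
    using PW m by (intro mult_left_mono divide_left_mono power_mono) auto
  finally show ?thesis by (simp add: P_def W_def m1_def m2_def)
qed

end
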